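(* Let $\Gamma$ be the game over simplices defined in the context, and let $\tau>0$ satisfy $\tau\le\min\{1/\delta_f,\,1/\delta_f^2\}$. Consider the multi-objective optimization problem $$\min_{x\in\hat{\Delta}^{\tau}} l_{i,j}^{\tau}(x),\qquad i\in[N],\ j\in[n_i],$$ where a solution is a point $x\in\hat{\Delta}^{\tau}$ that minimizes all the functions $l_{i,j}^{\tau}$ over $\hat{\Delta}^{\tau}$ simultaneously. There exists a solution to this problem, with optimal value $l_{i,j}^{\tau,*}=0$ for each objective function. Moreover, the solution set of this problem is the set of Nash equilibria of the game $\Gamma^{\tau,t}$.
   Context: Write $[N]=\{1,\dots,N\}$ and let $n_i\ge 1$ be integers. The game $\Gamma$ has $N$ players. Player $i$ has action set the simplex $\Delta_i=\{x_i=(x_i^1,\dots,x_i^{n_i+1})\in\mathbb{R}_+^{n_i+1}:\sum_{j=1}^{n_i+1}x_i^j=1\}$, and $\Delta=\Delta_1\times\dots\times\Delta_N$. Player $i$ maximizes the utility $f_i:\Delta\to\mathbb{R}$, $f_i(x)=\sum_{k\ne i}x_i^TQ_{ik}x_k+\sum_{j=1}^N r_j^Tx_j$, where $Q_{ik}$ are arbitrary real $(n_i+1)\times(n_k+1)$ matrices and $r_j\in\mathbb{R}^{n_j+1}$. Put $\delta_f=\max_{i\in[N]}(\max_{x\in\Delta}f_i(x)-\min_{x\in\Delta}f_i(x))$ (with $1/0=+\infty$). A Nash equilibrium of a game with action sets $A_i$ and utilities $g_i$ is a joint action $x^*\in\prod_i A_i$ with $g_i(x_i^*,x_{-i}^*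 )\ge g_i(x_i,x_{-i}^* )$ for all $i$ and all $x_i\in A_i$, where $x_{-i}$ denotes the actions of all players other than $i$. Transformed regularized game: $\Delta_i^t=\{x_i=(x_i^1,\dots,x_i^{n_i})\in\mathbb{R}_+^{n_i}:\sum_{j=1}^{n_i}x_i^j\le 1\}$, $\Delta^t=\prod_{i=1}^N\Delta_i^t$ (the superscript $t$ stands for "transformed"). For $x\in\Delta^t$, $f_i^t(x)$ is the value of $f_i$ at the lift of $x$ to $\Delta$, obtained by setting $x_k^{n_k+1}=1-\sum_{j=1}^{n_k}x_k^j$ for all $k\in[N]$. The game $\Gamma^{\tau,t}$ has action sets $\Delta_i^t$ and utilities (with $0\ln 0=0$) $$f_i^{\tau,t}(x)=f_i^t(x)-\tau\sum_{j=1}^{n_i}x_i^j\ln(x_i^j)-\tau\Big(1-\sum_{j=1}^{n_i}x_i^j\Big)\ln\Big(1-\sum_{j=1}^{n_i}x_i^j\Big).$$ Since $f_i$ is affine in each $x_k$ and has no quadratic term in $x_i$, one has $\frac{\partial f_i^t}{\partial x_i^j}(x)=\hat r_i^j+\sum_{k\ne i}\langle\hat q_{ik}^j,x_k\rangle$ for constants $\hat r_i^j\in\mathbb{R}$ and vectors $\hat q_{ik}^j\in\mathbb{R}^{n_k}$ determined by the game. The objective functions are, for $i\in[N]$, $j\in[n_i]$, $$l_{i,j}^{\tau}(x)=\Big(\frac{\partial f_i^{\tau,t}}{\partial x_i^j}(x)\Big)^2=\Big(\hat r_i^j+\sum_{k\ne i}\langle\hat q_{ik}^j,x_k\rangle-\tau\ln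 x_i^j+\tau\ln\big(1-\sum_{\ell=1}^{n_i}x_i^\ell\big)\Big)^2.$$ With $M=\max_{i\in[N]}(n_i+1)$, the constraint set is $\hat{\Delta}^{\tau}=\prod_{i=1}^N\hat{\Delta}_i^{\tau}$, where $$\hat{\Delta}_i^{\tau}=\Big\{x_i\in\mathbb{R}^{n_i}: x_i^j\ge\frac{e^{-1/\tau^2}}{M}\ \forall j\in[n_i],\ \ \sum_{j=1}^{n_i}x_i^j\le 1-\frac{e^{-1/\tau^{1.5}}}{M}\Big\}.$$ *)

theory Defs
  imports "HOL-Analysis.Analysis"
begin

text \<open>
  The players are $1, \dots, N$. Vectors in $\mathbb{R}^m$ are functions on $\{1, \dots, m\}$ that are
  extensional (fixed to \<^const>\<open>undefined\<close> elsewhere), and joint actions are extensional functions on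
  the set of players. Thus equality of functions is equality of vectors and of joint actions, and
  sets of joint actions can be compared as sets.
\<close>

definition nash_equilibria ::
  "'p set \<Rightarrow> ('p \<Rightarrow> 'a set) \<Rightarrow> ('p \<Rightarrow> ('p \<Rightarrow> 'a) \<Rightarrow> real) \<Rightarrow> ('p \<Rightarrow> 'a) set" where
  "nash_equilibria P A g =
     {x \<in> Pi\<^sub>E P A. \<forall>i\<in>P. \<forall>y\<in>A i. g i x \<ge> g i (x(i := y))}"

definition simultaneous_minimizers :: "'k set \<Rightarrow> 'b set \<Rightarrow> ('k \<Rightarrow> 'b \<Rightarrow> real) \<Rightarrow> 'b set" where
  "simultaneous_minimizers K C l = {x \<in> C. \<forall>k\<in>K. \<forall>y\<in>C. l k x \<le> l k y}"

definition action_simplex :: "nat \<Rightarrow> (nat \<Rightarrow> real) set" where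
  "action_simplex m = {v \<in> {1..m + 1} \<rightarrow>\<^sub>E {0..}. (\<Sum>j=1..m + 1. v j) = 1}"

definition simplex_t :: "nat \<Rightarrow> (nat \<Rightarrow> real) set" where
  "simplex_t m = {v \<in> {1..m} \<rightarrow>\<^sub>E {0..}. (\<Sum>j=1..m. v j) \<le> 1}"

definition joint_simplex :: "nat \<Rightarrow> (nat \<Rightarrow> nat) \<Rightarrow> (nat \<Rightarrow> nat \<Rightarrow> real) set" where
  "joint_simplex N n = (\<Pi>\<^sub>E i\<in>{1..N}. action_simplex (n i))"

text \<open>\<open>Q i k a b\<close> is the entry in row \<open>a\<close> and column \<open>b\<close> of $Q_{ik}$, and \<open>r k a\<close> is the
  \<open>a\<close>-th component of $r_k$.\<close>

definition utility ::
  "nat \<Rightarrow> (nat \<Rightarrow> nat) \<Rightarrow> (nat \<Rightarrow> nat \<Rightarrow> nat \<Rightarrow> nat \<Rightarrow> real) \<Rightarrow> (nat \<Rightarrow> nat \<Rightarrow> real)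
     \<Rightarrow> nat \<Rightarrow> (nat \<Rightarrow> nat \<Rightarrow> real) \<Rightarrow> real" where
  "utility N n Q r i x =
     (\<Sum>k\<in>{1..N} - {i}. \<Sum>a=1..n i + 1. \<Sum>b=1..n k + 1. x i a * Q i k a b * x k b)
     + (\<Sum>k=1..N. \<Sum>a=1..n k + 1. r k a * x k a)"

text \<open>The utilities are continuous on the nonempty compact joint simplex, so the supremum and the
  infimum are a maximum and a minimum.\<close>

definition utility_range ::
  "nat \<Rightarrow> (nat \<Rightarrow> nat) \<Rightarrow> (nat \<Rightarrow> nat \<Rightarrow> nat \<Rightarrow> nat \<Rightarrow> real) \<Rightarrow> (nat \<Rightarrow> nat \<Rightarrow> real) \<Rightarrow> real" where
  "utility_range N n Q r =
     (MAX i\<in>{1..N}. (SUP x\<in>joint_simplex N n. utility N n Q r i x)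
                     - (INF x\<in>joint_simplex N n. utility N n Q r i x))"

definition lift :: "nat \<Rightarrow> (nat \<Rightarrow> nat) \<Rightarrow> (nat \<Rightarrow> nat \<Rightarrow> real) \<Rightarrow> (nat \<Rightarrow> nat \<Rightarrow> real)" where
  "lift N n x = (\<lambda>k\<in>{1..N}. \<lambda>j\<in>{1..n k + 1}.
     if j = n k + 1 then 1 - (\<Sum>l=1..n k. x k l) else x k j)"

definition utility_t ::
  "nat \<Rightarrow> (nat \<Rightarrow> nat) \<Rightarrow> (nat \<Rightarrow> nat \<Rightarrow> nat \<Rightarrow> nat \<Rightarrow> real) \<Rightarrow> (nat \<Rightarrow> nat \<Rightarrow> real)
     \<Rightarrow> nat \<Rightarrow> (nat \<Rightarrow> nat \<Rightarrow> real) \<Rightarrow> real" where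
  "utility_t N n Q r i x = utility N n Q r i (lift N n x)"

text \<open>The convention $0 \ln 0 = 0$ holds because the logarithm is multiplied by $0$.\<close>

definition reg_utility_t ::
  "nat \<Rightarrow> (nat \<Rightarrow> nat) \<Rightarrow> (nat \<Rightarrow> nat \<Rightarrow> nat \<Rightarrow> nat \<Rightarrow> real) \<Rightarrow> (nat \<Rightarrow> nat \<Rightarrow> real)
     \<Rightarrow> real \<Rightarrow> nat \<Rightarrow> (nat \<Rightarrow> nat \<Rightarrow> real) \<Rightarrow> real" where
  "reg_utility_t N n Q r \<tau> i x =
     utility_t N n Q r i x
     - \<tau> * (\<Sum>j=1..n i. x i j * ln (x i j))
     - \<tau> * (1 - (\<Sum>j=1..n i. x i j)) * ln (1 - (\<Sum>j=1..n i. x i j))"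

text \<open>The square of the partial derivative of the regularized utility of player \<open>i\<close> with respect to
  $x_i^j$. It is only used on the constraint set, where the partial derivative exists; see
  \<open>objective_eq\<close> below for its explicit form.\<close>

definition objective ::
  "nat \<Rightarrow> (nat \<Rightarrow> nat) \<Rightarrow> (nat \<Rightarrow> nat \<Rightarrow> nat \<Rightarrow> nat \<Rightarrow> real) \<Rightarrow> (nat \<Rightarrow> nat \<Rightarrow> real)
     \<Rightarrow> real \<Rightarrow> nat \<Rightarrow> nat \<Rightarrow> (nat \<Rightarrow> nat \<Rightarrow> real) \<Rightarrow> real" where
  "objective N n Q r \<tau> i j x =
     (deriv (\<lambda>s. reg_utility_t N n Q r \<tau> i (x(i := (x i)(j := s)))) (x i j))\<^sup>2"

definition max_actions :: "nat \<Rightarrow> (nat \<Rightarrow> nat) \<Rightarrow> nat" where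
  "max_actions N n = (MAX i\<in>{1..N}. n i + 1)"

definition hat_simplex :: "real \<Rightarrow> nat \<Rightarrow> nat \<Rightarrow> (nat \<Rightarrow> real) set" where
  "hat_simplex \<tau> M m =
     {v \<in> {1..m} \<rightarrow>\<^sub>E UNIV.
        (\<forall>j\<in>{1..m}. v j \<ge> exp (- 1 / \<tau>\<^sup>2) / real M)
        \<and> (\<Sum>j=1..m. v j) \<le> 1 - exp (- 1 / \<tau> powr (3 / 2)) / real M}"

definition constraint_set :: "nat \<Rightarrow> (nat \<Rightarrow> nat) \<Rightarrow> real \<Rightarrow> (nat \<Rightarrow> nat \<Rightarrow> real) set" where
  "constraint_set N n \<tau> = (\<Pi>\<^sub>E i\<in>{1..N}. hat_simplex \<tau> (max_actions N n) (n i))"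

definition solution_set ::
  "nat \<Rightarrow> (nat \<Rightarrow> nat) \<Rightarrow> (nat \<Rightarrow> nat \<Rightarrow> nat \<Rightarrow> nat \<Rightarrow> real) \<Rightarrow> (nat \<Rightarrow> nat \<Rightarrow> real)
     \<Rightarrow> real \<Rightarrow> (nat \<Rightarrow> nat \<Rightarrow> real) set" where
  "solution_set N n Q r \<tau> =
     simultaneous_minimizers (SIGMA i:{1..N}. {1..n i}) (constraint_set N n \<tau>)
       (\<lambda>(i, j). objective N n Q r \<tau> i j)"

definition q_hat ::
  "(nat \<Rightarrow> nat) \<Rightarrow> (nat \<Rightarrow> nat \<Rightarrow> nat \<Rightarrow> nat \<Rightarrow> real) \<Rightarrow> nat \<Rightarrow> nat \<Rightarrow> nat \<Rightarrow> nat \<Rightarrow> real" where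
  "q_hat n Q i k j b =
     Q i k j b - Q i k (n i + 1) b - Q i k j (n k + 1) + Q i k (n i + 1) (n k + 1)"

definition r_hat ::
  "nat \<Rightarrow> (nat \<Rightarrow> nat) \<Rightarrow> (nat \<Rightarrow> nat \<Rightarrow> nat \<Rightarrow> nat \<Rightarrow> real) \<Rightarrow> (nat \<Rightarrow> nat \<Rightarrow> real)
     \<Rightarrow> nat \<Rightarrow> nat \<Rightarrow> real" where
  "r_hat N n Q r i j =
     r i j - r i (n i + 1)
     + (\<Sum>k\<in>{1..N} - {i}. Q i k j (n k + 1) - Q i k (n i + 1) (n k + 1))"

lemma sum_upd_last:
  fixes c y :: "nat \<Rightarrow> real" and s :: real
  assumes j: "j \<in> {1..m}"
  shows "(\<Sum>a=1..m + 1. c a * (if a = m + 1 then 1 - (\<Sum>l=1..m. (y(j := s)) l) else (y(j := s)) a))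
    = (\<Sum>a=1..m + 1. c a * (if a = m + 1 then 1 - (\<Sum>l=1..m. y l) else y a))
      + (c j - c (m + 1)) * (s - y j)"
proof -
  have upd: "(\<Sum>a=1..m. d a * (y(j := s)) a) = (\<Sum>a=1..m. d a * y a) + d j * (s - y j)" for d
  proof -
    have "(\<Sum>a=1..m. d a * (y(j := s)) a) - (\<Sum>a=1..m. d a * y a)
        = (\<Sum>a=1..m. if a = j then d j * (s - y j) else 0)"
      unfolding sum_subtractf[symmetric] by (rule sum.cong) (auto simp: algebra_simps)
    also have "\<dots> = d j * (s - y j)" using j by simp
    finally show ?thesis by simp
  qed
  have split: "(\<Sum>a=1..m + 1. c a * (if a = m + 1 then t else z a))
      = (\<Sum>a=1..m. c a * z a) + c (m + 1) * t" for t z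
    by simp
  have e: "(\<Sum>l=1..m. (y(j := s)) l) = (\<Sum>l=1..m. y l) + (s - y j)"
    using upd[of "\<lambda>_. 1"] by (simp only: mult_1)
  show ?thesis
    unfolding split upd e by (simp only: algebra_simps)
qed

lemma utility_t_upd:
  assumes i: "i \<in> {1..N}" and j: "j \<in> {1..n i}"
  shows "utility_t N n Q r i (x(i := (x i)(j := s)))
    = utility_t N n Q r i x
      + (r_hat N n Q r i j + (\<Sum>k\<in>{1..N} - {i}. \<Sum>b=1..n k. q_hat n Q i k j b * x k b)) * (s - x i j)"
proof -
  let ?x = "x(i := (x i)(j := s))"
  define L where "L = lift N n x"
  define L' where "L' = lift N n ?x"
  have L'k: "L' k = L k" if "k \<noteq> i" for k
    using that by (auto simp: L_def L'_def lift_def restrict_def fun_eq_iff)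
  have Li: "L i a = (if a = n i + 1 then 1 - (\<Sum>l=1..n i. x i l) else x i a)"
    if "a \<in> {1..n i + 1}" for a
    using that i by (simp add: L_def lift_def)
  have L'i: "L' i a = (if a = n i + 1 then 1 - (\<Sum>l=1..n i. ((x i)(j := s)) l) else ((x i)(j := s)) a)"
    if "a \<in> {1..n i + 1}" for a
    using that i by (simp add: L'_def lift_def)
  have dL: "(\<Sum>a=1..n i + 1. c a * L' i a)
      = (\<Sum>a=1..n i + 1. c a * L i a) + (c j - c (n i + 1)) * (s - x i j)" for c
  proof -
    have "(\<Sum>a=1..n i + 1. c a * L' i a) = (\<Sum>a=1..n i + 1. c a *
        (if a = n i + 1 then 1 - (\<Sum>l=1..n i. ((x i)(j := s)) l) else ((x i)(j := s)) a))"
      by (rule sum.cong[OF refl]) (simp only: L'i)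
    moreover have "(\<Sum>a=1..n i + 1. c a * L i a) = (\<Sum>a=1..n i + 1. c a *
        (if a = n i + 1 then 1 - (\<Sum>l=1..n i. x i l) else x i a))"
      by (rule sum.cong[OF refl]) (simp only: Li)
    ultimately show ?thesis by (simp only: sum_upd_last[OF j])
  qed
  have A: "(\<Sum>a=1..n i + 1. \<Sum>b=1..n k + 1. L' i a * Q i k a b * L' k b)
      = (\<Sum>a=1..n i + 1. \<Sum>b=1..n k + 1. L i a * Q i k a b * L k b)
        + ((Q i k j (n k + 1) - Q i k (n i + 1) (n k + 1))
           + (\<Sum>b=1..n k. q_hat n Q i k j b * x k b)) * (s - x i j)"
    if k: "k \<in> {1..N} - {i}" for k
  proof -
    let ?c = "\<lambda>a. \<Sum>b=1..n k + 1. Q i k a b * L k b"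
    have c: "?c a = (\<Sum>b=1..n k. Q i k a b * x k b) + Q i k a (n k + 1) * (1 - (\<Sum>l=1..n k. x k l))" for a
      using k by (simp add: L_def lift_def)
    have d: "?c j - ?c (n i + 1) = (Q i k j (n k + 1) - Q i k (n i + 1) (n k + 1))
           + (\<Sum>b=1..n k. q_hat n Q i k j b * x k b)"
      unfolding c q_hat_def
      by (simp add: algebra_simps sum.distrib sum_subtractf)
         (simp add: sum_distrib_right[symmetric] sum_distrib_left[symmetric] algebra_simps)
    have e: "(\<Sum>a=1..n i + 1. \<Sum>b=1..n k + 1. y a * Q i k a b * L k b) = (\<Sum>a=1..n i + 1. ?c a * y a)" for y
      by (simp only: sum_distrib_left sum_distrib_right mult_ac)
    have "L' k = L k" using k L'k by auto
    then show ?thesis unfolding e[of "L i"] using dL[of ?c] d e[of "L' i"] by simp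
  qed
  have B: "(\<Sum>k=1..N. \<Sum>a=1..n k + 1. r k a * L' k a)
     = (\<Sum>k=1..N. \<Sum>a=1..n k + 1. r k a * L k a) + (r i j - r i (n i + 1)) * (s - x i j)"
  proof -
    have "(\<Sum>k=1..N. \<Sum>a=1..n k + 1. r k a * L' k a)
      = (\<Sum>a=1..n i + 1. r i a * L' i a) + (\<Sum>k\<in>{1..N} - {i}. \<Sum>a=1..n k + 1. r k a * L' k a)"
      using i by (intro sum.remove) auto
    also have "(\<Sum>k\<in>{1..N} - {i}. \<Sum>a=1..n k + 1. r k a * L' k a)
       = (\<Sum>k\<in>{1..N} - {i}. \<Sum>a=1..n k + 1. r k a * L k a)"
      using L'k by (intro sum.cong) auto
    also have "(\<Sum>a=1..n i + 1. r i a * L' i a)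
       = (\<Sum>a=1..n i + 1. r i a * L i a) + (r i j - r i (n i + 1)) * (s - x i j)"
      by (rule dL)
    finally have "(\<Sum>k=1..N. \<Sum>a=1..n k + 1. r k a * L' k a)
      = (\<Sum>a=1..n i + 1. r i a * L i a) + (r i j - r i (n i + 1)) * (s - x i j)
        + (\<Sum>k\<in>{1..N} - {i}. \<Sum>a=1..n k + 1. r k a * L k a)" .
    moreover have "(\<Sum>k=1..N. \<Sum>a=1..n k + 1. r k a * L k a)
      = (\<Sum>a=1..n i + 1. r i a * L i a) + (\<Sum>k\<in>{1..N} - {i}. \<Sum>a=1..n k + 1. r k a * L k a)"
      using i by (intro sum.remove) auto
    ultimately show ?thesis by (simp only: algebra_simps)
  qed
  have "(\<Sum>k\<in>{1..N} - {i}. \<Sum>a=1..n i + 1. \<Sum>b=1..n k + 1. L' i a * Q i k a b * L' k b)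
    = (\<Sum>k\<in>{1..N} - {i}. (\<Sum>a=1..n i + 1. \<Sum>b=1..n k + 1. L i a * Q i k a b * L k b)
        + ((Q i k j (n k + 1) - Q i k (n i + 1) (n k + 1))
           + (\<Sum>b=1..n k. q_hat n Q i k j b * x k b)) * (s - x i j))"
    by (rule sum.cong[OF refl A])
  then show ?thesis
    unfolding utility_t_def L_def[symmetric] L'_def[symmetric] utility_def B r_hat_def
    by (simp only: sum.distrib sum_distrib_right[symmetric]) (simp add: algebra_simps)
qed

lemma reg_utility_t_has_partial_derivative:
  assumes i: "i \<in> {1..N}" and j: "j \<in> {1..n i}"
    and pos: "x i j > 0" and less: "(\<Sum>l=1..n i. x i l) < 1"
  shows "((\<lambda>s. reg_utility_t N n Q r \<tau> i (x(i := (x i)(j := s)))) has_field_derivative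
      (r_hat N n Q r i j + (\<Sum>k\<in>{1..N} - {i}. \<Sum>b=1..n k. q_hat n Q i k j b * x k b)
       - \<tau> * ln (x i j) + \<tau> * ln (1 - (\<Sum>l=1..n i. x i l)))) (at (x i j))"
proof -
  define S where "S = (\<Sum>l\<in>{1..n i} - {j}. x i l)"
  define H where "H = (\<Sum>l\<in>{1..n i} - {j}. x i l * ln (x i l))"
  define D where "D = r_hat N n Q r i j + (\<Sum>k\<in>{1..N} - {i}. \<Sum>b=1..n k. q_hat n Q i k j b * x k b)"
  have S: "(\<Sum>l=1..n i. ((x i)(j := s)) l) = s + S" for s
    using j by (subst sum.remove[of _ j]) (auto simp: S_def intro!: sum.cong)
  have H: "(\<Sum>l=1..n i. ((x i)(j := s)) l * ln (((x i)(j := s)) l)) = s * ln s + H" for s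
    using j by (subst sum.remove[of _ j]) (auto simp: H_def intro!: sum.cong)
  have S0: "(\<Sum>l=1..n i. x i l) = x i j + S" using S[of "x i j"] by simp
  have eq: "(\<lambda>s. reg_utility_t N n Q r \<tau> i (x(i := (x i)(j := s)))) =
     (\<lambda>s. utility_t N n Q r i x + D * (s - x i j) - \<tau> * (s * ln s + H)
          - \<tau> * (1 - (s + S)) * ln (1 - (s + S)))"
    unfolding reg_utility_t_def utility_t_upd[of i N j n, OF i j] D_def[symmetric]
    by (simp only: fun_upd_same S H)
  have d1: "((\<lambda>s. s * ln s + H) has_field_derivative ln (x i j) + 1) (at (x i j))"
    using pos by (auto intro!: derivative_eq_intros)
  have d2: "((\<lambda>s. (1 - (s + S)) * ln (1 - (s + S))) has_field_derivative
      - ln (1 - (x i j + S)) - 1) (at (x i j))"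
  proof -
    have "1 - (x i j + S) > 0" using less S0 by simp
    moreover from this have "1 - (x i j + S) \<noteq> 0" by (rule less_imp_neq[symmetric])
    ultimately show ?thesis
      by (auto intro!: derivative_eq_intros simp del: diff_gt_0_iff_gt)
  qed
  show ?thesis
    unfolding eq D_def[symmetric] S0 mult.assoc
    by (rule derivative_eq_intros d1 d2 refl)+ (simp add: algebra_simps)
qed

lemma objective_eq:
  assumes "i \<in> {1..N}" and "j \<in> {1..n i}"
    and "x i j > 0" and "(\<Sum>l=1..n i. x i l) < 1"
  shows "objective N n Q r \<tau> i j x =
      (r_hat N n Q r i j + (\<Sum>k\<in>{1..N} - {i}. \<Sum>b=1..n k. q_hat n Q i k j b * x k b)
       - \<tau> * ln (x i j) + \<tau> * ln (1 - (\<Sum>l=1..n i. x i l)))\<^sup>2"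
  unfolding objective_def
  by (simp only: DERIV_imp_deriv[OF reg_utility_t_has_partial_derivative[of i N j n x, OF assms]])

end

theory Submission
  imports Defs
begin

text \<open>Both the solutions and the Nash equilibria turn out to be the logit equilibria of the game, the joint
actions in which each player's lifted action \<open>w\<close> is the softmax of the payoffs of the pure actions,
divided by \<open>\<tau>\<close>.

For the Nash equilibria, the utility of a player is affine in the player's own action, so the
regularized utility is the average payoff under \<open>w\<close> plus \<open>\<tau>\<close> times the entropy of \<open>w\<close>. By the Gibbs
variational principle (\<open>softmax_unique_maximizer\<close>) softmax is its only maximizer on the closed simplex
(\<open>best_response_iff_logit\<close>). For the objectives, the partial derivative with respect to \<open>x\<^sub>i\<^sup>j\<close> compares
\<open>payoff - \<tau> ln w\<close> for the pure action \<open>j\<close> with its value for the last pure action; all these differences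
vanish precisely at softmax (\<open>objectives_zero_iff_logit\<close>).

The two sets of joint actions over which these statements range are different, and the bounds on \<open>\<tau>\<close>
reconcile them. Payoffs of pure actions differ by at most \<open>\<delta>\<close>, the range of the utilities, so every
softmax weight is at least \<open>exp (- \<delta> / \<tau>) / M\<close>, and the hypothesis on \<open>\<tau>\<close> bounds \<open>\<delta> / \<tau>\<close> by both \<open>1 / \<tau>\<^sup>2\<close> and
\<open>1 / \<tau> powr (3 / 2)\<close>. Hence logit equilibria lie in the constraint set, which in turn is contained in the
product of the simplices.

A logit equilibrium exists by Brouwer's fixed point theorem. It provides a common zero of the
nonnegative objectives in the constraint set, and therefore the simultaneous minimizers are exactly
the common zeros.\<close>

section \<open>Brouwer's theorem for cubes of countable dimension\<close>

text \<open>The approximate fixed points that Kuhn's combinatorial lemma supplies. Only the coordinates whose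
number is below the mesh parameter \<open>p\<close> vary along the grid; the others are kept at \<open>0\<close>. Colouring a
grid point by the direction in which \<open>f\<close> moves a coordinate is an admissible labelling, and in the
small cell that the lemma provides each varying coordinate is pushed weakly up at one corner \<open>a\<close> and
weakly down at another corner \<open>b\<close>.\<close>

lemma kuhn_approximate_fixed_point:
  fixes f :: "('k :: countable \<Rightarrow> real) \<Rightarrow> 'k \<Rightarrow> real" and p :: nat
  defines "S \<equiv> {x. \<forall>k. 0 \<le> x k \<and> x k \<le> 1}"
  assumes "0 < p" and into: "f ` S \<subseteq> S"
  shows "\<exists>z\<in>S. \<forall>k. to_nat k < p \<longrightarrow>
    (\<exists>a\<in>S. \<exists>b\<in>S. (\<forall>j. \<bar>a j - z j\<bar> \<le> 1 / p \<and> \<bar>b j - z j\<bar> \<le> 1 / p)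
      \<and> a k \<le> f a k \<and> f b k \<le> b k)"
proof -
  define grid :: "(nat \<Rightarrow> nat) \<Rightarrow> 'k \<Rightarrow> real" where
    "grid = (\<lambda>v k. if to_nat k < p then v (to_nat k) / p else 0)"
  \<comment> \<open>The boundary values come first because Kuhn's lemma prescribes the labels there; the colours
    still tell the direction of \<open>f\<close>, which maps into the cube.\<close>
  define colour :: "('k \<Rightarrow> real) \<Rightarrow> 'k \<Rightarrow> nat" where
    "colour = (\<lambda>x k. if x k = 0 then 0 else if x k = 1 then 1 else if x k \<le> f x k then 0 else 1)"
  \<comment> \<open>The numbering \<open>to_nat\<close> may skip some of the \<open>p\<close> grid coordinates; their labels only have to
    respect the two boundary conditions.\<close>
  define label :: "(nat \<Rightarrow> nat) \<Rightarrow> nat \<Rightarrow> nat" where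
    "label = (\<lambda>v i. if i \<in> range (to_nat :: 'k \<Rightarrow> nat) then colour (grid v) (from_nat i)
       else if v i = 0 then 0 else 1)"
  have gridS: "grid v \<in> S" if "\<forall>i<p. v i \<le> p" for v
    using that \<open>0 < p\<close> by (auto simp: S_def grid_def)
  have range: "0 \<le> f x k \<and> f x k \<le> 1" if "x \<in> S" for x k
    using into that unfolding S_def by blast
  have colour0: "x k \<le> f x k" if "x \<in> S" "colour x k = 0" for x k
    using that range[of x k] by (simp add: colour_def split: if_splits)
  have colour1: "f x k \<le> x k" if "x \<in> S" "colour x k = 1" for x k
    using that range[of x k] by (simp add: colour_def split: if_splits)
  have label01: "label v i = 0 \<or> label v i = 1" for v i
    by (simp add: label_def colour_def)
  have label0: "label v i = 0" if "v i = 0" "i < p" for v i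
    using that by (auto simp: label_def colour_def grid_def)
  have label1: "label v i = 1" if "v i = p" "i < p" for v i
  proof (cases "i \<in> range (to_nat :: 'k \<Rightarrow> nat)")
    case True
    then obtain k :: 'k where "i = to_nat k" by blast
    then have "grid v (from_nat i) = 1" using that by (simp add: grid_def)
    then show ?thesis using True by (simp add: label_def colour_def)
  qed (use that \<open>0 < p\<close> in \<open>simp add: label_def\<close>)
  obtain q where q: "\<forall>i<p. q i < p"
    and qr: "\<forall>i<p. \<exists>r s. (\<forall>j<p. q j \<le> r j \<and> r j \<le> q j + 1) \<and> (\<forall>j<p. q j \<le> s j \<and> s j \<le> q j + 1)
        \<and> label r i \<noteq> label s i"
    by (rule kuhn_lemma[of p p label]) (use \<open>0 < p\<close> label01 label0 label1 in auto)
  have near: "grid v \<in> S \<and> (\<forall>j. \<bar>grid v j - grid q j\<bar> \<le> 1 / p)"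
    if v: "\<forall>j<p. q j \<le> v j \<and> v j \<le> q j + 1" for v
  proof
    show "grid v \<in> S" using v q by (intro gridS allI impI) (metis Suc_leI Suc_eq_plus1 le_trans)
    show "\<forall>j. \<bar>grid v j - grid q j\<bar> \<le> 1 / p"
    proof
      fix j :: 'k
      show "\<bar>grid v j - grid q j\<bar> \<le> 1 / p"
      proof (cases "to_nat j < p")
        case True
        then have "\<bar>real (v (to_nat j)) - real (q (to_nat j))\<bar> \<le> 1"
          using v by fastforce
        then show ?thesis using True \<open>0 < p\<close>
          by (simp add: grid_def diff_divide_distrib[symmetric] divide_right_mono)
      qed (simp add: grid_def)
    qed
  qed
  have pair: "\<exists>a\<in>S. \<exists>b\<in>S. (\<forall>j. \<bar>a j - grid q j\<bar> \<le> 1 / p \<and> \<bar>b j - grid q j\<bar> \<le> 1 / p)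
      \<and> a k \<le> f a k \<and> f b k \<le> b k" if k: "to_nat k < p" for k
  proof -
    obtain r s where rs: "\<forall>j<p. q j \<le> r j \<and> r j \<le> q j + 1" "\<forall>j<p. q j \<le> s j \<and> s j \<le> q j + 1"
      and ne: "label r (to_nat k) \<noteq> label s (to_nat k)"
      using qr k by blast
    have lab: "label v (to_nat k) = colour (grid v) k" for v
      by (simp add: label_def)
    have witness: ?thesis if "colour (grid u) k = 0" "colour (grid v) k = 1"
        "\<forall>j<p. q j \<le> u j \<and> u j \<le> q j + 1" "\<forall>j<p. q j \<le> v j \<and> v j \<le> q j + 1" for u v
      by (rule bexI[of _ "grid u"], rule bexI[of _ "grid v"])
        (use that near[of u] near[of v] colour0[of "grid u" k] colour1[of "grid v" k] in auto)
    from ne label01[of r "to_nat k"] label01[of s "to_nat k"] show ?thesis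
      unfolding lab using witness[of r s] witness[of s r] rs by auto
  qed
  have "grid q \<in> S" using q by (intro gridS) (auto intro: less_imp_le)
  then show ?thesis using pair by blast
qed

lemma compact_cube: "compact {x :: 'k \<Rightarrow> real. \<forall>k. 0 \<le> x k \<and> x k \<le> 1}"
proof -
  have "compactin (product_topology (\<lambda>_. euclidean) UNIV)
      (PiE (UNIV :: 'k set) (\<lambda>_. {0..1 :: real}))"
    by (subst compactin_PiE) auto
  moreover have "PiE (UNIV :: 'k set) (\<lambda>_. {0..1}) = {x. \<forall>k. 0 \<le> x k \<and> x k \<le> (1 :: real)}"
    by (auto simp: PiE_def Pi_def)
  ultimately show ?thesis
    by (simp add: euclidean_product_topology)
qed

text \<open>Brouwer's theorem for a cube with countably many coordinates. The dimension of the space of joint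
actions depends on the numbers of players and of actions, so it cannot be fixed by a Euclidean type;
a cube indexed by all pairs of natural numbers contains every such space. The number of grid
coordinates and the fineness of the grid grow together, so for a limit point of the approximate
fixed points the two inequalities at the corners of the cells pass to the limit in each coordinate
separately and give equality there.\<close>

theorem brouwer_hilbert_cube:
  fixes f :: "('k :: countable \<Rightarrow> real) \<Rightarrow> 'k \<Rightarrow> real"
  defines "S \<equiv> {x. \<forall>k. 0 \<le> x k \<and> x k \<le> 1}"
  assumes cont: "continuous_on S f" and into: "f ` S \<subseteq> S"
  shows "\<exists>x\<in>S. f x = x"
proof -
  have "\<forall>p. \<exists>z\<in>S. \<forall>k. to_nat k < Suc p \<longrightarrow>
    (\<exists>a\<in>S. \<exists>b\<in>S. (\<forall>j. \<bar>a j - z j\<bar> \<le> 1 / Suc p \<and> \<bar>b j - z j\<bar> \<le> 1 / Suc p)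
      \<and> a k \<le> f a k \<and> f b k \<le> b k)"
    using kuhn_approximate_fixed_point[of "Suc _" f] into unfolding S_def by blast
  then obtain z where zS: "z p \<in> S"
    and z: "to_nat k < Suc p \<Longrightarrow> \<exists>a\<in>S. \<exists>b\<in>S.
      (\<forall>j. \<bar>a j - z p j\<bar> \<le> 1 / Suc p \<and> \<bar>b j - z p j\<bar> \<le> 1 / Suc p) \<and> a k \<le> f a k \<and> f b k \<le> b k"
    for p k by metis
  \<comment> \<open>The index type is countable, so the product topology is metrizable and compactness gives a
    convergent subsequence.\<close>
  obtain w \<sigma> where wS: "w \<in> S" and \<sigma>: "strict_mono \<sigma>" and lim: "(z \<circ> \<sigma>) \<longlonglongrightarrow> w"
    using compact_cube[where 'k = 'k] zS unfolding compact_def S_def by meson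
  have coord: "((\<lambda>m. u m k) \<longlonglongrightarrow> v k)" if "u \<longlonglongrightarrow> v" for u :: "nat \<Rightarrow> 'k \<Rightarrow> real" and v k
    using continuous_on_tendsto_compose[OF continuous_on_product_coordinates[where i = k] that]
    by simp
  have nearby: "u \<longlonglongrightarrow> w"
    if u: "\<And>m j. \<bar>u m j - z (\<sigma> (m + d)) j\<bar> \<le> 1 / Suc (\<sigma> (m + d))" for u d
  proof -
    have "(\<lambda>m. u m j) \<longlonglongrightarrow> w j" for j
    proof -
      have "(\<lambda>m. z (\<sigma> (m + d)) j) \<longlonglongrightarrow> w j"
        using LIMSEQ_ignore_initial_segment[OF coord[OF lim, of j], of d] by simp
      moreover have "(\<lambda>m. u m j - z (\<sigma> (m + d)) j) \<longlonglongrightarrow> 0"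
      proof (rule Lim_null_comparison)
        show "\<forall>\<^sub>F m in sequentially. norm (u m j - z (\<sigma> (m + d)) j) \<le> 1 / Suc m"
        proof (intro always_eventually allI)
          fix m
          have "m \<le> \<sigma> (m + d)" using seq_suble[OF \<sigma>, of "m + d"] by simp
          then have "1 / real (Suc (\<sigma> (m + d))) \<le> 1 / Suc m" by (simp add: frac_le)
          then show "norm (u m j - z (\<sigma> (m + d)) j) \<le> 1 / Suc m" using u[of m j] by simp
        qed
        show "(\<lambda>m. 1 / real (Suc m)) \<longlonglongrightarrow> 0" by (rule LIMSEQ_Suc[OF lim_1_over_n])
      qed
      ultimately show ?thesis using tendsto_add by fastforce
    qed
    then have "limitin (product_topology (\<lambda>_. euclidean) UNIV) u w sequentially"
      by (subst limitin_componentwise) auto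
    then show ?thesis by (simp add: euclidean_product_topology)
  qed
  have "f w k = w k" for k
  proof -
    \<comment> \<open>The coordinate \<open>k\<close> takes part in the grid only from index \<open>to_nat k\<close> on, so the sequences start
      there.\<close>
    define d where "d = to_nat k"
    have "\<forall>m. \<exists>a\<in>S. \<exists>b\<in>S. (\<forall>j. \<bar>a j - z (\<sigma> (m + d)) j\<bar> \<le> 1 / Suc (\<sigma> (m + d))
        \<and> \<bar>b j - z (\<sigma> (m + d)) j\<bar> \<le> 1 / Suc (\<sigma> (m + d))) \<and> a k \<le> f a k \<and> f b k \<le> b k"
    proof
      fix m
      have "to_nat k < Suc (\<sigma> (m + d))"
        using seq_suble[OF \<sigma>, of "m + d"] by (simp add: d_def)
      then show "\<exists>a\<in>S. \<exists>b\<in>S. (\<forall>j. \<bar>a j - z (\<sigma> (m + d)) j\<bar> \<le> 1 / Suc (\<sigma> (m + d))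
        \<and> \<bar>b j - z (\<sigma> (m + d)) j\<bar> \<le> 1 / Suc (\<sigma> (m + d))) \<and> a k \<le> f a k \<and> f b k \<le> b k"
        by (rule z)
    qed
    then obtain a b where ab: "\<And>m. a m \<in> S" "\<And>m. b m \<in> S"
      "\<And>m j. \<bar>a m j - z (\<sigma> (m + d)) j\<bar> \<le> 1 / Suc (\<sigma> (m + d))"
      "\<And>m j. \<bar>b m j - z (\<sigma> (m + d)) j\<bar> \<le> 1 / Suc (\<sigma> (m + d))"
      "\<And>m. a m k \<le> f (a m) k" "\<And>m. f (b m) k \<le> b m k"
      by metis
    have lims: "(\<lambda>m. u m k) \<longlonglongrightarrow> w k" "(\<lambda>m. f (u m) k) \<longlonglongrightarrow> f w k"
      if "u \<longlonglongrightarrow> w" "\<And>m. u m \<in> S" for u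
    proof -
      show "(\<lambda>m. u m k) \<longlonglongrightarrow> w k" by (rule coord[OF that(1)])
      have "(\<lambda>m. f (u m)) \<longlonglongrightarrow> f w"
        by (rule continuous_on_tendsto_compose[OF cont that(1) wS]) (simp add: that(2))
      then show "(\<lambda>m. f (u m) k) \<longlonglongrightarrow> f w k" by (rule coord)
    qed
    note a = lims[OF nearby[of a d, OF ab(3)] ab(1)] and b = lims[OF nearby[of b d, OF ab(4)] ab(2)]
    have "w k \<le> f w k" using ab(5) by (intro LIMSEQ_le[OF a]) auto
    moreover have "f w k \<le> w k" using ab(6) by (intro LIMSEQ_le[OF b(2) b(1)]) auto
    ultimately show ?thesis by simp
  qed
  then show ?thesis using wS by blast
qed

section \<open>Softmax and entropy-regularized maximization\<close>

definition softmax :: "'a set \<Rightarrow> ('a \<Rightarrow> real) \<Rightarrow> 'a \<Rightarrow> real" where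
  "softmax A u a = exp (u a) / (\<Sum>b\<in>A. exp (u b))"

lemma softmax_denominator_pos:
  "finite A \<Longrightarrow> A \<noteq> {} \<Longrightarrow> 0 < (\<Sum>b\<in>A. exp (u b :: real))"
  by (rule sum_pos) auto

lemma softmax_pos: "finite A \<Longrightarrow> A \<noteq> {} \<Longrightarrow> 0 < softmax A u a"
  by (simp add: softmax_def softmax_denominator_pos)

lemma sum_softmax: "finite A \<Longrightarrow> A \<noteq> {} \<Longrightarrow> (\<Sum>a\<in>A. softmax A u a) = 1"
  using softmax_denominator_pos[of A u] by (simp add: softmax_def flip: sum_divide_distrib)

lemma ln_softmax:
  "finite A \<Longrightarrow> A \<noteq> {} \<Longrightarrow> ln (softmax A u a) = u a - ln (\<Sum>b\<in>A. exp (u b))"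
  using softmax_denominator_pos[of A u] by (simp add: softmax_def ln_div)

text \<open>The reciprocal of a softmax weight is the sum of the exponentials of the differences \<open>u b - u a\<close>. This
turns a bound on the payoffs into a bound that keeps equilibria away from the boundary.\<close>

lemma softmax_lower_bound:
  assumes "finite A" "a \<in> A" and diff: "\<And>b. b \<in> A \<Longrightarrow> u b - u a \<le> d"
  shows "exp (- d) / card A \<le> softmax A u a"
proof -
  have "(\<Sum>b\<in>A. exp (u b)) \<le> (\<Sum>b\<in>A. exp d * exp (u a))"
    using diff by (intro sum_mono) (simp add: algebra_simps flip: exp_add)
  also have "\<dots> = card A * exp d * exp (u a)" by simp
  finally have le: "(\<Sum>b\<in>A. exp (u b)) \<le> card A * exp d * exp (u a)" .
  have pos: "0 < (\<Sum>b\<in>A. exp (u b))" using assms by (intro softmax_denominator_pos) auto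
  have "exp (- d) / card A = exp (u a) / (card A * exp d * exp (u a))"
    by (simp add: exp_minus field_simps)
  also have "\<dots> \<le> softmax A u a"
    unfolding softmax_def using le pos by (intro divide_left_mono) (auto intro: mult_pos_pos less_le_trans)
  finally show ?thesis .
qed

text \<open>On the interior of the simplex, softmax is the only point at which \<open>u a - ln (w a)\<close> takes the same
value for all actions: these equations say that \<open>w a\<close> is proportional to \<open>exp (u a)\<close>, and
normalization fixes the factor. They are the first-order conditions for entropy-regularized maximization.\<close>

lemma softmax_characterization:
  assumes A: "finite A" "c \<in> A" and pos: "\<And>a. a \<in> A \<Longrightarrow> 0 < w a" and sum: "(\<Sum>a\<in>A. w a) = 1"
  shows "(\<forall>a\<in>A. w a = softmax A u a) \<longleftrightarrow> (\<forall>a\<in>A. u a - ln (w a) = u c - ln (w c))"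
proof
  have ne: "A \<noteq> {}" using A by auto
  assume "\<forall>a\<in>A. w a = softmax A u a"
  then show "\<forall>a\<in>A. u a - ln (w a) = u c - ln (w c)"
    using A ne by (simp add: ln_softmax)
next
  assume eq: "\<forall>a\<in>A. u a - ln (w a) = u c - ln (w c)"
  define \<mu> where "\<mu> = u c - ln (w c)"
  have exp_u: "exp (u a) = exp \<mu> * w a" if "a \<in> A" for a
  proof -
    have "u a = \<mu> + ln (w a)" using eq that unfolding \<mu>_def by (smt (verit) that)
    then show ?thesis using pos[OF that] by (simp add: exp_add)
  qed
  have "(\<Sum>a\<in>A. exp (u a)) = exp \<mu>"
    using sum by (simp add: exp_u flip: sum_distrib_left)
  then show "\<forall>a\<in>A. w a = softmax A u a"
    by (simp add: softmax_def exp_u)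
qed

text \<open>Nonnegativity of the relative entropy, including its equality case. Each term satisfies
\<open>w (ln p - ln w) \<le> p - w\<close>, because \<open>ln t \<le> t - 1\<close> with equality only at \<open>t = 1\<close>, and the right-hand
sides sum to \<open>0\<close>. Weights \<open>w a = 0\<close> are allowed, which covers the boundary of the simplex.\<close>

lemma gibbs_inequality:
  fixes w p :: "'a \<Rightarrow> real"
  assumes "finite A"
    and p: "\<And>a. a \<in> A \<Longrightarrow> 0 < p a" and w: "\<And>a. a \<in> A \<Longrightarrow> 0 \<le> w a"
    and sums: "(\<Sum>a\<in>A. p a) = 1" "(\<Sum>a\<in>A. w a) = 1"
  shows "(\<Sum>a\<in>A. w a * (ln (p a) - ln (w a))) \<le> 0"
    and "(\<Sum>a\<in>A. w a * (ln (p a) - ln (w a))) = 0 \<longleftrightarrow> (\<forall>a\<in>A. w a = p a)"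
proof -
  let ?g = "\<lambda>a. (p a - w a) - w a * (ln (p a) - ln (w a))"
  have g: "0 \<le> ?g a \<and> (?g a = 0 \<longleftrightarrow> w a = p a)" if a: "a \<in> A" for a
  proof (cases "w a = 0")
    case True
    then show ?thesis using p[OF a] by simp
  next
    case False
    then have "0 < w a" using w[OF a] by simp
    then have g_eq: "?g a = w a * ((p a / w a - 1) - ln (p a / w a))"
      using p[OF a] by (simp add: ln_div field_simps)
    have "0 < p a / w a" using p[OF a] \<open>0 < w a\<close> by simp
    moreover from this have "ln (p a / w a) = p a / w a - 1 \<longleftrightarrow> p a / w a = 1"
      using ln_eq_minus_one[of "p a / w a"] by auto
    moreover have "p a / w a = 1 \<longleftrightarrow> w a = p a" using \<open>0 < w a\<close> by auto
    ultimately show ?thesis unfolding g_eq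
      using ln_le_minus_one[of "p a / w a"] \<open>0 < w a\<close> by (auto simp: zero_le_mult_iff)
  qed
  have total: "(\<Sum>a\<in>A. ?g a) = - (\<Sum>a\<in>A. w a * (ln (p a) - ln (w a)))"
    using sums by (simp add: sum_subtractf)
  have "0 \<le> (\<Sum>a\<in>A. ?g a)" using g by (intro sum_nonneg) auto
  then show "(\<Sum>a\<in>A. w a * (ln (p a) - ln (w a))) \<le> 0" unfolding total by simp
  have "(\<Sum>a\<in>A. ?g a) = 0 \<longleftrightarrow> (\<forall>a\<in>A. ?g a = 0)"
    using g by (intro sum_nonneg_eq_0_iff) (auto simp: \<open>finite A\<close>)
  then show "(\<Sum>a\<in>A. w a * (ln (p a) - ln (w a))) = 0 \<longleftrightarrow> (\<forall>a\<in>A. w a = p a)"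
    unfolding total using g by simp
qed

text \<open>The Gibbs variational principle: up to the constant \<open>m\<close>, the regularized payoff of \<open>w\<close> is \<open>- \<tau>\<close> times
the relative entropy of \<open>w\<close> with respect to softmax. It shows optimality on the whole simplex without
any derivative, hence at boundary points as well.\<close>

lemma softmax_unique_maximizer:
  fixes w u :: "'a \<Rightarrow> real"
  assumes A: "finite A" "A \<noteq> {}" and "0 < \<tau>"
    and w: "\<And>a. a \<in> A \<Longrightarrow> 0 \<le> w a" "(\<Sum>a\<in>A. w a) = 1"
  defines "value \<equiv> \<lambda>w. (\<Sum>a\<in>A. w a * u a) - \<tau> * (\<Sum>a\<in>A. w a * ln (w a))"
    and "m \<equiv> \<tau> * ln (\<Sum>a\<in>A. exp (u a / \<tau>))"
  shows "value w \<le> m" and "value w = m \<longleftrightarrow> (\<forall>a\<in>A. w a = softmax A (\<lambda>a. u a / \<tau>) a)"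
proof -
  let ?p = "softmax A (\<lambda>a. u a / \<tau>)"
  have u: "u a = \<tau> * ln (?p a) + m" for a
    using \<open>0 < \<tau>\<close> unfolding ln_softmax[OF A] m_def by (simp add: right_diff_distrib)
  have "(\<Sum>a\<in>A. w a * u a) = (\<Sum>a\<in>A. \<tau> * (w a * ln (?p a)) + w a * m)"
    by (subst u) (simp add: algebra_simps)
  also have "\<dots> = \<tau> * (\<Sum>a\<in>A. w a * ln (?p a)) + m"
    using w(2) by (simp add: sum.distrib flip: sum_distrib_left sum_distrib_right)
  finally have eq: "value w = m + \<tau> * (\<Sum>a\<in>A. w a * (ln (?p a) - ln (w a)))"
    unfolding value_def by (simp add: algebra_simps sum_subtractf)
  note gibbs = gibbs_inequality[of A ?p w, OF A(1) softmax_pos[OF A] w(1) sum_softmax[OF A] w(2)]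
  show "value w \<le> m"
    unfolding eq using gibbs(1) \<open>0 < \<tau>\<close> by (simp add: mult_nonneg_nonpos)
  show "value w = m \<longleftrightarrow> (\<forall>a\<in>A. w a = ?p a)"
    unfolding eq using gibbs(2) \<open>0 < \<tau>\<close> by simp
qed

section \<open>Utilities at the vertices of the simplices\<close>

definition vertex :: "nat \<Rightarrow> nat \<Rightarrow> nat \<Rightarrow> real" where
  "vertex m a = (\<lambda>b\<in>{1..m + 1}. of_bool (b = a))"

lemma vertex_in_action_simplex: "a \<in> {1..m + 1} \<Longrightarrow> vertex m a \<in> action_simplex m"
  by (auto simp: action_simplex_def vertex_def PiE_def)

lemma lift_apply:
  "k \<in> {1..N} \<Longrightarrow> b \<in> {1..n k + 1} \<Longrightarrow>
    lift N n x k b = (if b = n k + 1 then 1 - (\<Sum>l=1..n k. x k l) else x k b)"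
  by (simp add: lift_def)

lemma sum_lift: "k \<in> {1..N} \<Longrightarrow> (\<Sum>b=1..n k + 1. lift N n x k b) = 1"
  by (simp add: lift_apply)

lemma lift_upd_other: "k \<noteq> i \<Longrightarrow> lift N n (x(i := y)) k = lift N n x k"
  by (auto simp: lift_def fun_eq_iff)

lemma lift_nonneg:
  assumes "x k \<in> simplex_t (n k)" "k \<in> {1..N}" "b \<in> {1..n k + 1}"
  shows "0 \<le> lift N n x k b"
  using assms by (auto simp: lift_apply simplex_t_def PiE_iff)

lemma lift_in_joint_simplex:
  assumes "x \<in> (\<Pi>\<^sub>E i\<in>{1..N}. simplex_t (n i))"
  shows "lift N n x \<in> joint_simplex N n"
  unfolding joint_simplex_def
proof (rule PiE_I)
  fix k assume k: "k \<in> {1..N}"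
  have "lift N n x k \<in> extensional {1..n k + 1}" using k by (simp add: lift_def)
  moreover have "0 \<le> lift N n x k b" if "b \<in> {1..n k + 1}" for b
    using assms k that by (intro lift_nonneg) auto
  ultimately show "lift N n x k \<in> action_simplex (n k)"
    using sum_lift[OF k, of n x] by (auto simp: action_simplex_def PiE_iff)
qed (auto simp: lift_def restrict_def)

text \<open>There is no term quadratic in the player's own action, so the utility is affine in it, and
an affine function takes an affine combination of the vertices to that combination of its values.\<close>

lemma utility_own_action_affine:
  assumes i: "i \<in> {1..N}" and w: "(\<Sum>a=1..n i + 1. w a) = 1"
  shows "utility N n Q r i (X(i := w))
    = (\<Sum>a=1..n i + 1. w a * utility N n Q r i (X(i := vertex (n i) a)))"
proof -
  define c where "c = (\<lambda>a. (\<Sum>k\<in>{1..N} - {i}. \<Sum>b=1..n k + 1. Q i k a b * X k b) + r i a)"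
  define R where "R = (\<Sum>k\<in>{1..N} - {i}. \<Sum>a=1..n k + 1. r k a * X k a)"
  have form: "utility N n Q r i (X(i := v)) = (\<Sum>a=1..n i + 1. v a * c a) + R" for v
  proof -
    have "(\<Sum>k\<in>{1..N} - {i}. \<Sum>a=1..n i + 1. \<Sum>b=1..n k + 1. v a * Q i k a b * (X(i := v)) k b)
        = (\<Sum>a=1..n i + 1. \<Sum>k\<in>{1..N} - {i}. \<Sum>b=1..n k + 1. v a * Q i k a b * X k b)"
      by (subst sum.swap) (auto intro!: sum.cong)
    moreover have "(\<Sum>k=1..N. \<Sum>a=1..n k + 1. r k a * (X(i := v)) k a)
        = (\<Sum>a=1..n i + 1. r i a * v a) + R"
      using i by (subst sum.remove[of _ i]) (auto simp: R_def intro!: sum.cong)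
    ultimately show ?thesis
      by (simp add: utility_def c_def distrib_left sum.distrib sum_distrib_left mult_ac del: sum.cl_ivl_Suc)
  qed
  have vert: "utility N n Q r i (X(i := vertex (n i) a)) = c a + R" if "a \<in> {1..n i + 1}" for a
  proof -
    have "(\<Sum>b=1..n i + 1. vertex (n i) a b * c b) = (\<Sum>b=1..n i + 1. if b = a then c b else 0)"
      by (rule sum.cong) (auto simp: vertex_def)
    also have "\<dots> = c a" using that by (simp del: sum.cl_ivl_Suc)
    finally show ?thesis by (simp add: form)
  qed
  have "(\<Sum>a=1..n i + 1. w a * utility N n Q r i (X(i := vertex (n i) a)))
      = (\<Sum>a=1..n i + 1. w a * c a + w a * R)"
    by (rule sum.cong) (simp_all add: vert distrib_left del: fun_upd_apply)
  also have "\<dots> = (\<Sum>a=1..n i + 1. w a * c a) + R"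
    using w by (simp add: sum.distrib flip: sum_distrib_right del: sum.cl_ivl_Suc)
  finally show ?thesis by (simp only: form)
qed

text \<open>A supremum or an infimum of real numbers is informative only for a bounded set; this makes the
ones in the definition of the utility range actual bounds for the utilities.\<close>

lemma utility_bounded:
  assumes i: "i \<in> {1..N}"
  shows "\<exists>C. \<forall>X\<in>joint_simplex N n. \<bar>utility N n Q r i X\<bar> \<le> C"
proof (intro exI ballI)
  fix X assume "X \<in> joint_simplex N n"
  then have X: "X k \<in> action_simplex (n k)" if "k \<in> {1..N}" for k
    using that by (auto simp: joint_simplex_def)
  have X01: "\<bar>X k a\<bar> \<le> 1" if "k \<in> {1..N}" "a \<in> {1..n k + 1}" for k a
  proof -
    have nn: "\<And>b. b \<in> {1..n k + 1} \<Longrightarrow> 0 \<le> X k b" and s: "(\<Sum>b=1..n k + 1. X k b) = 1"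
      using X[OF that(1)] by (auto simp: action_simplex_def PiE_iff)
    have "X k a \<le> (\<Sum>b=1..n k + 1. X k b)" using nn that(2) by (intro member_le_sum) auto
    then show ?thesis using s nn[OF that(2)] by simp
  qed
  have "\<bar>\<Sum>k\<in>{1..N} - {i}. \<Sum>a=1..n i + 1. \<Sum>b=1..n k + 1. X i a * Q i k a b * X k b\<bar>
      \<le> (\<Sum>k\<in>{1..N} - {i}. \<Sum>a=1..n i + 1. \<Sum>b=1..n k + 1. \<bar>Q i k a b\<bar>)"
  proof (intro order_trans[OF sum_abs] sum_mono)
    fix k a b assume "k \<in> {1..N} - {i}" "a \<in> {1..n i + 1}" "b \<in> {1..n k + 1}"
    then have "\<bar>X i a\<bar> * \<bar>X k b\<bar> \<le> 1 * 1" using i X01 by (intro mult_mono) auto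
    then have "(\<bar>X i a\<bar> * \<bar>X k b\<bar>) * \<bar>Q i k a b\<bar> \<le> 1 * \<bar>Q i k a b\<bar>"
      by (intro mult_right_mono) auto
    then show "\<bar>X i a * Q i k a b * X k b\<bar> \<le> \<bar>Q i k a b\<bar>" by (simp add: abs_mult mult_ac)
  qed
  moreover have "\<bar>\<Sum>k=1..N. \<Sum>a=1..n k + 1. r k a * X k a\<bar> \<le> (\<Sum>k=1..N. \<Sum>a=1..n k + 1. \<bar>r k a\<bar>)"
  proof (intro order_trans[OF sum_abs] sum_mono)
    fix k a assume "k \<in> {1..N}" "a \<in> {1..n k + 1}"
    then show "\<bar>r k a * X k a\<bar> \<le> \<bar>r k a\<bar>"
      using X01 by (simp add: abs_mult mult_left_le)
  qed
  ultimately show "\<bar>utility N n Q r i X\<bar>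
      \<le> (\<Sum>k\<in>{1..N} - {i}. \<Sum>a=1..n i + 1. \<Sum>b=1..n k + 1. \<bar>Q i k a b\<bar>)
        + (\<Sum>k=1..N. \<Sum>a=1..n k + 1. \<bar>r k a\<bar>)"
    unfolding utility_def by linarith
qed

lemma utility_diff_le_range:
  assumes i: "i \<in> {1..N}" and X: "X \<in> joint_simplex N n" and Y: "Y \<in> joint_simplex N n"
  shows "utility N n Q r i X - utility N n Q r i Y \<le> utility_range N n Q r"
proof -
  let ?u = "utility N n Q r"
  obtain C where C: "\<And>X. X \<in> joint_simplex N n \<Longrightarrow> \<bar>?u i X\<bar> \<le> C"
    using utility_bounded[OF i] by blast
  have "?u i X \<le> (SUP x\<in>joint_simplex N n. ?u i x)"
    using C by (intro cSUP_upper[OF X] bdd_aboveI2[of _ _ C]) (auto simp: abs_le_iff)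
  moreover have "(INF x\<in>joint_simplex N n. ?u i x) \<le> ?u i Y"
    using C by (intro cINF_lower[OF _ Y] bdd_belowI2[of _ "- C"]) (auto simp: abs_le_iff minus_le_iff)
  moreover have "(SUP x\<in>joint_simplex N n. ?u i x) - (INF x\<in>joint_simplex N n. ?u i x)
      \<le> utility_range N n Q r"
    unfolding utility_range_def using i by (intro Max_ge) auto
  ultimately show ?thesis by linarith
qed

lemma continuous_on_utility:
  assumes "i \<in> {1..N}"
    and "\<And>k b. k \<in> {1..N} \<Longrightarrow> b \<in> {1..n k + 1} \<Longrightarrow> continuous_on S (\<lambda>c. X c k b)"
  shows "continuous_on S (\<lambda>c. utility N n Q r i (X c))"
  unfolding utility_def using assms by (intro continuous_intros) auto

section \<open>Logit equilibria of the regularized game\<close>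

locale regularized_game =
  fixes N :: nat and n :: "nat \<Rightarrow> nat"
    and Q :: "nat \<Rightarrow> nat \<Rightarrow> nat \<Rightarrow> nat \<Rightarrow> real" and r :: "nat \<Rightarrow> nat \<Rightarrow> real" and \<tau> :: real
  assumes \<tau>_pos: "0 < \<tau>"
begin

abbreviation profiles :: "(nat \<Rightarrow> nat \<Rightarrow> real) set" where
  "profiles \<equiv> \<Pi>\<^sub>E i\<in>{1..N}. simplex_t (n i)"

definition pure_payoff :: "nat \<Rightarrow> (nat \<Rightarrow> nat \<Rightarrow> real) \<Rightarrow> nat \<Rightarrow> real" where
  "pure_payoff i x a = utility N n Q r i ((lift N n x)(i := vertex (n i) a))"

definition logit :: "nat \<Rightarrow> (nat \<Rightarrow> nat \<Rightarrow> real) \<Rightarrow> nat \<Rightarrow> real" where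
  "logit i x = softmax {1..n i + 1} (\<lambda>a. pure_payoff i x a / \<tau>)"

text \<open>The common description of both sets in the main result: each player's lifted action, last
component included, is the logit response to the actions of the others.\<close>

definition logit_equilibrium :: "(nat \<Rightarrow> nat \<Rightarrow> real) \<Rightarrow> bool" where
  "logit_equilibrium x \<longleftrightarrow> (\<forall>i\<in>{1..N}. \<forall>a\<in>{1..n i + 1}. lift N n x i a = logit i x a)"

lemma pure_payoff_upd_own: "pure_payoff i (x(i := y)) = pure_payoff i x"
proof -
  have eq: "(lift N n (x(i := y)))(i := v) = (lift N n x)(i := v)" for v
    by (rule ext) (simp add: lift_upd_other)
  show ?thesis by (rule ext) (simp only: pure_payoff_def eq)
qed

lemma reg_utility_t_eq:
  assumes i: "i \<in> {1..N}"
  shows "reg_utility_t N n Q r \<tau> i x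
    = (\<Sum>a=1..n i + 1. lift N n x i a * pure_payoff i x a)
      - \<tau> * (\<Sum>a=1..n i + 1. lift N n x i a * ln (lift N n x i a))"
proof -
  have "utility_t N n Q r i x = utility N n Q r i ((lift N n x)(i := lift N n x i))"
    by (simp add: utility_t_def)
  also have "\<dots> = (\<Sum>a=1..n i + 1. lift N n x i a * pure_payoff i x a)"
    unfolding pure_payoff_def using i by (intro utility_own_action_affine sum_lift)
  finally show ?thesis
    using i by (simp add: reg_utility_t_def lift_apply algebra_simps)
qed

text \<open>By \<open>reg_utility_t_eq\<close> the player maximizes an entropy-regularized average of payoffs, and these payoffs
depend only on the opponents; the Gibbs variational principle gives the unique maximizer.\<close>

lemma best_response_iff_logit:
  assumes x: "x \<in> profiles" and i: "i \<in> {1..N}"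
  shows "(\<forall>y\<in>simplex_t (n i). reg_utility_t N n Q r \<tau> i x \<ge> reg_utility_t N n Q r \<tau> i (x(i := y)))
    \<longleftrightarrow> (\<forall>a\<in>{1..n i + 1}. lift N n x i a = logit i x a)"
proof -
  let ?A = "{1..n i + 1}" and ?g = "reg_utility_t N n Q r \<tau> i"
  define m where "m = \<tau> * ln (\<Sum>a\<in>?A. exp (pure_payoff i x a / \<tau>))"
  have g_le: "?g (x(i := y)) \<le> m"
    and g_eq: "?g (x(i := y)) = m \<longleftrightarrow> (\<forall>a\<in>?A. lift N n (x(i := y)) i a = logit i x a)"
    if y: "y \<in> simplex_t (n i)" for y
  proof -
    have nonneg: "0 \<le> lift N n (x(i := y)) i a" if "a \<in> ?A" for a
      by (rule lift_nonneg) (use i y that in auto)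
    note max = softmax_unique_maximizer[of ?A \<tau> "lift N n (x(i := y)) i" "pure_payoff i x",
        OF _ _ \<tau>_pos nonneg sum_lift[OF i]]
    show "?g (x(i := y)) \<le> m"
      using max(1) unfolding reg_utility_t_eq[OF i] pure_payoff_upd_own m_def by simp
    show "?g (x(i := y)) = m \<longleftrightarrow> (\<forall>a\<in>?A. lift N n (x(i := y)) i a = logit i x a)"
      using max(2) unfolding reg_utility_t_eq[OF i] pure_payoff_upd_own m_def logit_def by simp
  qed
  have xi: "x i \<in> simplex_t (n i)" using x i by auto
  \<comment> \<open>The bound \<open>m\<close> is attained: the logit response, deprived of its last component, is an action.\<close>
  define y where "y = restrict (logit i x) {1..n i}"
  have sum_logit: "(\<Sum>a\<in>?A. logit i x a) = 1"
    unfolding logit_def by (rule sum_softmax) auto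
  have logit_pos: "0 < logit i x a" for a
    unfolding logit_def by (rule softmax_pos) auto
  have sum_y: "(\<Sum>a=1..n i. y a) = 1 - logit i x (n i + 1)"
    using sum_logit by (simp add: y_def)
  have y: "y \<in> simplex_t (n i)"
    using sum_y logit_pos by (auto simp: simplex_t_def y_def less_imp_le)
  have "lift N n (x(i := y)) i a = logit i x a" if "a \<in> ?A" for a
    using i that sum_y by (auto simp: lift_apply) (auto simp: y_def)
  then have y_max: "?g (x(i := y)) = m" using g_eq[OF y] by blast
  have "(\<forall>y\<in>simplex_t (n i). ?g x \<ge> ?g (x(i := y))) \<longleftrightarrow> ?g x = m"
    using y_max y g_le g_le[OF xi] by (metis fun_upd_triv antisym)
  also have "\<dots> \<longleftrightarrow> (\<forall>a\<in>?A. lift N n x i a = logit i x a)"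
    using g_eq[OF xi] by simp
  finally show ?thesis .
qed

lemma nash_equilibria_eq_logit_equilibria:
  "nash_equilibria {1..N} (\<lambda>i. simplex_t (n i)) (reg_utility_t N n Q r \<tau>)
    = {x \<in> profiles. logit_equilibrium x}"
  unfolding nash_equilibria_def logit_equilibrium_def
  using best_response_iff_logit by blast

text \<open>Raising \<open>x\<^sub>i\<^sup>j\<close> moves mass from the last pure action to the action \<open>j\<close>. As the utility is affine in the
own action, the partial derivative can be read off from the two vertices.\<close>

lemma gradient_eq_payoff_difference:
  assumes i: "i \<in> {1..N}" and j: "j \<in> {1..n i}"
  shows "r_hat N n Q r i j + (\<Sum>k\<in>{1..N} - {i}. \<Sum>b=1..n k. q_hat n Q i k j b * x k b)
    = pure_payoff i x j - pure_payoff i x (n i + 1)"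
proof -
  \<comment> \<open>The formula does not involve the action of player \<open>i\<close>, which can therefore be moved to the last
    vertex, represented by the origin.\<close>
  define z where "z = x(i := \<lambda>_. 0)"
  have vertex_lift: "utility_t N n Q r i (x(i := y)) = pure_payoff i x a"
    if "a \<in> {1..n i + 1}" "y = (\<lambda>l. of_bool (l = a \<and> l \<le> n i))" for a y
  proof -
    have "lift N n (x(i := y)) i = vertex (n i) a"
      using that i by (auto simp: lift_def vertex_def fun_eq_iff restrict_def of_bool_def)
    then have "lift N n (x(i := y)) = (lift N n x)(i := vertex (n i) a)"
      by (auto simp: fun_eq_iff lift_upd_other)
    then show ?thesis by (simp add: utility_t_def pure_payoff_def)
  qed
  have "utility_t N n Q r i (z(i := (z i)(j := 1))) = pure_payoff i x j"
    unfolding z_def fun_upd_upd by (rule vertex_lift) (use j in auto)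
  moreover have "utility_t N n Q r i z = pure_payoff i x (n i + 1)"
    unfolding z_def by (rule vertex_lift) auto
  moreover have "(\<Sum>k\<in>{1..N} - {i}. \<Sum>b=1..n k. q_hat n Q i k j b * z k b)
      = (\<Sum>k\<in>{1..N} - {i}. \<Sum>b=1..n k. q_hat n Q i k j b * x k b)"
    by (auto simp: z_def intro!: sum.cong)
  ultimately show ?thesis
    using utility_t_upd[of i N j n, OF i j, of Q r z 1] by (simp add: z_def)
qed

text \<open>The objectives are the squared components of the gradient, so they vanish exactly when the
first-order conditions of \<open>softmax_characterization\<close> hold.\<close>

lemma objectives_zero_iff_logit:
  assumes i: "i \<in> {1..N}"
    and pos: "\<And>j. j \<in> {1..n i} \<Longrightarrow> 0 < x i j" and less: "(\<Sum>j=1..n i. x i j) < 1"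
  shows "(\<forall>j\<in>{1..n i}. objective N n Q r \<tau> i j x = 0)
    \<longleftrightarrow> (\<forall>a\<in>{1..n i + 1}. lift N n x i a = logit i x a)"
proof -
  let ?A = "{1..n i + 1}" and ?w = "lift N n x i"
  have A: "?A = insert (n i + 1) {1..n i}" by auto
  have w_pos: "0 < ?w a" if "a \<in> ?A" for a
    using that pos less i by (auto simp: lift_apply)
  have "objective N n Q r \<tau> i j x = 0
      \<longleftrightarrow> pure_payoff i x j / \<tau> - ln (?w j) = pure_payoff i x (n i + 1) / \<tau> - ln (?w (n i + 1))"
    if j: "j \<in> {1..n i}" for j
  proof -
    have w: "?w j = x i j" "?w (n i + 1) = 1 - (\<Sum>l=1..n i. x i l)"
      using i j by (auto simp: lift_apply)
    show ?thesis
      unfolding objective_eq[of i N j n x, OF i j pos[OF j] less] w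
        gradient_eq_payoff_difference[OF i j]
      using \<tau>_pos by (auto simp: field_simps)
  qed
  then have "(\<forall>j\<in>{1..n i}. objective N n Q r \<tau> i j x = 0) \<longleftrightarrow>
      (\<forall>a\<in>?A. pure_payoff i x a / \<tau> - ln (?w a) = pure_payoff i x (n i + 1) / \<tau> - ln (?w (n i + 1)))"
    unfolding A by auto
  also have "\<dots> \<longleftrightarrow> (\<forall>a\<in>?A. ?w a = logit i x a)"
    unfolding logit_def
    by (rule softmax_characterization[symmetric]) (use w_pos sum_lift[OF i] in auto)
  finally show ?thesis .
qed

subsection \<open>Bounds for logit responses\<close>

lemma pure_payoff_diff_le_range:
  assumes x: "x \<in> profiles" and i: "i \<in> {1..N}" and ab: "a \<in> {1..n i + 1}" "b \<in> {1..n i + 1}"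
  shows "pure_payoff i x a - pure_payoff i x b \<le> utility_range N n Q r"
proof -
  have "(lift N n x)(i := vertex (n i) c) \<in> joint_simplex N n" if "c \<in> {1..n i + 1}" for c
    using lift_in_joint_simplex[OF x] vertex_in_action_simplex[OF that] i
    unfolding joint_simplex_def by (auto simp: PiE_iff extensional_def)
  then show ?thesis
    unfolding pure_payoff_def using i ab by (intro utility_diff_le_range)
qed

lemma logit_lower_bound:
  assumes x: "x \<in> profiles" and i: "i \<in> {1..N}" and a: "a \<in> {1..n i + 1}"
    and d: "utility_range N n Q r / \<tau> \<le> d"
  shows "exp (- d) / max_actions N n \<le> logit i x a"
proof -
  have "exp (- d) / max_actions N n \<le> exp (- d) / card {1..n i + 1}"
  proof -
    have "n i + 1 \<le> max_actions N n"
      unfolding max_actions_def using i by (intro Max_ge) auto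
    then show ?thesis by (intro divide_left_mono) auto
  qed
  also have "\<dots> \<le> logit i x a"
    unfolding logit_def
  proof (rule softmax_lower_bound)
    fix b assume b: "b \<in> {1..n i + 1}"
    have "pure_payoff i x b / \<tau> - pure_payoff i x a / \<tau> \<le> utility_range N n Q r / \<tau>"
      using pure_payoff_diff_le_range[OF x i b a] \<tau>_pos
      by (simp add: divide_right_mono flip: diff_divide_distrib)
    then show "pure_payoff i x b / \<tau> - pure_payoff i x a / \<tau> \<le> d" using d by simp
  qed (use a in auto)
  finally show ?thesis .
qed

lemma constraint_set_interior:
  assumes x: "x \<in> constraint_set N n \<tau>" and i: "i \<in> {1..N}"
  shows "j \<in> {1..n i} \<Longrightarrow> 0 < x i j" and "(\<Sum>j=1..n i. x i j) < 1"
proof -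
  have "n i + 1 \<le> max_actions N n"
    unfolding max_actions_def using i by (intro Max_ge) auto
  then have M: "0 < real (max_actions N n)" by simp
  have h: "x i \<in> hat_simplex \<tau> (max_actions N n) (n i)"
    using x i by (auto simp: constraint_set_def)
  have "0 < exp (- 1 / \<tau>\<^sup>2) / real (max_actions N n)" using M by simp
  then show "j \<in> {1..n i} \<Longrightarrow> 0 < x i j"
    using h unfolding hat_simplex_def by (auto intro: less_le_trans)
  have "0 < exp (- 1 / \<tau> powr (3 / 2)) / real (max_actions N n)" using M by simp
  then show "(\<Sum>j=1..n i. x i j) < 1"
    using h unfolding hat_simplex_def by auto
qed

lemma constraint_set_subset_profiles: "constraint_set N n \<tau> \<subseteq> profiles"
proof
  fix x assume x: "x \<in> constraint_set N n \<tau>"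
  show "x \<in> profiles"
  proof (rule PiE_I)
    fix i assume i: "i \<in> {1..N}"
    have "x i \<in> extensional {1..n i}"
      using x i by (auto simp: constraint_set_def hat_simplex_def PiE_iff)
    then show "x i \<in> simplex_t (n i)"
      using constraint_set_interior[OF x i] by (auto simp: simplex_t_def PiE_iff less_imp_le)
  qed (use x in \<open>auto simp: constraint_set_def\<close>)
qed

lemma logit_equilibrium_in_constraint_set:
  assumes x: "x \<in> profiles" and eq: "logit_equilibrium x"
    and d1: "utility_range N n Q r / \<tau> \<le> 1 / \<tau>\<^sup>2"
    and d2: "utility_range N n Q r / \<tau> \<le> 1 / \<tau> powr (3 / 2)"
  shows "x \<in> constraint_set N n \<tau>"
  unfolding constraint_set_def
proof (rule PiE_I)
  fix i assume i: "i \<in> {1..N}"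
  have lift: "lift N n x i a = logit i x a" if "a \<in> {1..n i + 1}" for a
    using eq i that by (auto simp: logit_equilibrium_def)
  have "exp (- 1 / \<tau>\<^sup>2) / max_actions N n \<le> x i j" if j: "j \<in> {1..n i}" for j
    using logit_lower_bound[OF x i _ d1, of j] lift[of j] i j by (simp add: lift_apply)
  moreover have "exp (- 1 / \<tau> powr (3 / 2)) / max_actions N n \<le> 1 - (\<Sum>j=1..n i. x i j)"
    using logit_lower_bound[OF x i _ d2, of "n i + 1"] lift[of "n i + 1"] i by (simp add: lift_apply)
  moreover have "x i \<in> extensional {1..n i}"
    using x i by (auto simp: simplex_t_def PiE_iff)
  ultimately show "x i \<in> hat_simplex \<tau> (max_actions N n) (n i)"
    by (auto simp: hat_simplex_def PiE_iff)
qed (use x in auto)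

subsection \<open>Existence of logit equilibria\<close>

text \<open>A logit equilibrium is a fixed point of the map that replaces all components by logit responses.
The logit formula makes sense and takes values in \<open>[0, 1]\<close> on the whole cube, not only on the product
of the simplices, so Brouwer's theorem applies to the cube; the components of a fixed point that
belong to actions are softmax values, so that the joint action lies in the product of the simplices.\<close>

lemma logit_equilibrium_exists: "\<exists>x\<in>profiles. logit_equilibrium x"
proof -
  define prof :: "(nat \<times> nat \<Rightarrow> real) \<Rightarrow> nat \<Rightarrow> nat \<Rightarrow> real" where
    "prof = (\<lambda>c. \<lambda>i\<in>{1..N}. \<lambda>j\<in>{1..n i}. c (i, j))"
  define F :: "(nat \<times> nat \<Rightarrow> real) \<Rightarrow> nat \<times> nat \<Rightarrow> real" where
    "F = (\<lambda>c (i, j). if i \<in> {1..N} \<and> j \<in> {1..n i} then logit i (prof c) j else 0)"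
  let ?S = "{c :: nat \<times> nat \<Rightarrow> real. \<forall>k. 0 \<le> c k \<and> c k \<le> 1}"
  have sum_logit: "(\<Sum>a=1..n i + 1. logit i x a) = 1" for i x
    unfolding logit_def by (rule sum_softmax) auto
  have logit_pos: "0 < logit i x a" for i x a
    unfolding logit_def by (rule softmax_pos) auto
  have logit_le: "logit i x a \<le> 1" if "a \<in> {1..n i + 1}" for i x a
    using member_le_sum[of a "{1..n i + 1}" "logit i x"] that logit_pos sum_logit[of i x]
    by (auto simp: less_imp_le)
  have "continuous_on ?S (\<lambda>c. F c (i, j))" for i j
  proof (cases "i \<in> {1..N} \<and> j \<in> {1..n i}")
    case True
    have coord: "continuous_on ?S (\<lambda>c. c k)" for k :: "nat \<times> nat"
      by (rule continuous_on_subset[OF continuous_on_product_coordinates]) simp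
    have lift_prof: "continuous_on ?S (\<lambda>c. lift N n (prof c) k b)"
      if "k \<in> {1..N}" "b \<in> {1..n k + 1}" for k b
    proof (cases "b = n k + 1")
      case True
      then have "(\<lambda>c. lift N n (prof c) k b) = (\<lambda>c. 1 - (\<Sum>l=1..n k. c (k, l)))"
        using that by (simp add: lift_apply prof_def)
      then show ?thesis by (simp only:) (intro continuous_intros coord)
    next
      case False
      then have "(\<lambda>c. lift N n (prof c) k b) = (\<lambda>c. c (k, b))"
        using that by (auto simp: lift_apply prof_def)
      then show ?thesis by (simp only: coord)
    qed
    have "continuous_on ?S (\<lambda>c. pure_payoff i (prof c) a)" for a
      unfolding pure_payoff_def
    proof (rule continuous_on_utility)
      fix k b assume "k \<in> {1..N}" "b \<in> {1..n k + 1}"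
      then show "continuous_on ?S (\<lambda>c. ((lift N n (prof c))(i := vertex (n i) a)) k b)"
        using lift_prof by (cases "k = i") auto
    qed (use True in simp)
    moreover have "(\<Sum>a=1..n i + 1. exp (pure_payoff i (prof c) a / \<tau>)) \<noteq> 0" for c
      by (rule less_imp_neq[symmetric], rule softmax_denominator_pos) auto
    ultimately have "continuous_on ?S (\<lambda>c. logit i (prof c) j)"
      unfolding logit_def softmax_def using \<tau>_pos by (intro continuous_intros) auto
    then show ?thesis using True by (simp add: F_def)
  qed (auto simp: F_def)
  then have "continuous_on ?S F"
    by (intro continuous_on_coordinatewise_then_product) auto
  moreover have "F ` ?S \<subseteq> ?S"
    using logit_pos logit_le by (auto simp: F_def less_imp_le)
  ultimately obtain c where c: "F c = c"
    using brouwer_hilbert_cube by blast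
  have logit_c: "prof c i j = logit i (prof c) j" if "i \<in> {1..N}" "j \<in> {1..n i}" for i j
    using that fun_cong[OF c, of "(i, j)"] by (simp add: prof_def F_def)
  have sum_c: "1 - (\<Sum>j=1..n i. prof c i j) = logit i (prof c) (n i + 1)" if "i \<in> {1..N}" for i
    using sum_logit[of i "prof c"] logit_c[OF that] by simp
  have "prof c \<in> profiles"
  proof (rule PiE_I)
    fix i assume i: "i \<in> {1..N}"
    have "prof c i \<in> extensional {1..n i}" using i by (simp add: prof_def)
    then show "prof c i \<in> simplex_t (n i)"
      using logit_c[OF i] sum_c[OF i] logit_pos[of i "prof c"]
      by (auto simp: simplex_t_def PiE_iff less_imp_le) (smt (verit))
  qed (auto simp: prof_def)
  moreover have "logit_equilibrium (prof c)"
    using logit_c sum_c by (auto simp: logit_equilibrium_def lift_apply)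
  ultimately show ?thesis by blast
qed

end

section \<open>Solutions and Nash equilibria\<close>

text \<open>The two bounds on \<open>\<tau>\<close> are what the two exponents in the constraint set require: \<open>\<tau> \<delta> \<le> 1\<close> gives the
first, and \<open>\<tau> \<delta>\<^sup>2 \<le> 1\<close>, that is \<open>\<delta> \<le> 1 / sqrt \<tau>\<close>, the second. For \<open>\<delta> = 0\<close> both hold trivially.\<close>

lemma temperature_bounds:
  fixes \<tau> \<delta> :: real
  assumes "0 < \<tau>" "0 \<le> \<delta>" and le: "ereal \<tau> \<le> min (1 / ereal \<delta>) (1 / (ereal \<delta>)\<^sup>2)"
  shows "\<delta> / \<tau> \<le> 1 / \<tau>\<^sup>2" and "\<delta> / \<tau> \<le> 1 / \<tau> powr (3 / 2)"
proof -
  have "\<tau> * \<delta> \<le> 1 \<and> \<tau> * \<delta>\<^sup>2 \<le> 1"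
  proof (cases "\<delta> = 0")
    case False
    then have "0 < \<delta>" using \<open>0 \<le> \<delta>\<close> by simp
    then have "1 / ereal \<delta> = ereal (1 / \<delta>)" "1 / (ereal \<delta>)\<^sup>2 = ereal (1 / \<delta>\<^sup>2)"
      by (simp_all add: one_ereal_def)
    then have "\<tau> \<le> 1 / \<delta>" "\<tau> \<le> 1 / \<delta>\<^sup>2" using le by simp_all
    then show ?thesis using \<open>0 < \<delta>\<close> by (simp add: field_simps)
  qed simp
  then have h: "\<tau> * \<delta> \<le> 1" "\<tau> * \<delta>\<^sup>2 \<le> 1" by auto
  show "\<delta> / \<tau> \<le> 1 / \<tau>\<^sup>2"
    using h(1) \<open>0 < \<tau>\<close> by (simp add: field_simps power2_eq_square)
  have "\<tau> powr (3 / 2) = \<tau> * sqrt \<tau>"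
    using \<open>0 < \<tau>\<close> powr_add[of \<tau> 1 "1 / 2"] by (simp add: powr_half_sqrt)
  moreover have "sqrt \<tau> * \<delta> \<le> 1"
  proof -
    have "(sqrt \<tau> * \<delta>)\<^sup>2 \<le> 1\<^sup>2" using h(2) \<open>0 < \<tau>\<close> by (simp add: power_mult_distrib)
    then show ?thesis by (rule power2_le_imp_le) simp
  qed
  ultimately show "\<delta> / \<tau> \<le> 1 / \<tau> powr (3 / 2)"
    using \<open>0 < \<tau>\<close> by (simp add: field_simps)
qed

theorem lemma3:
  fixes N :: nat and n :: "nat \<Rightarrow> nat"
    and Q :: "nat \<Rightarrow> nat \<Rightarrow> nat \<Rightarrow> nat \<Rightarrow> real" and r :: "nat \<Rightarrow> nat \<Rightarrow> real" and \<tau> :: real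
  assumes "N \<ge> 1"
    and "\<And>i. i \<in> {1..N} \<Longrightarrow> n i \<ge> 1"
    and "\<tau> > 0"
    and "ereal \<tau> \<le> min (1 / ereal (utility_range N n Q r)) (1 / (ereal (utility_range N n Q r))\<^sup>2)"
  shows "solution_set N n Q r \<tau> \<noteq> {}
    \<and> (\<forall>x\<in>solution_set N n Q r \<tau>. \<forall>i\<in>{1..N}. \<forall>j\<in>{1..n i}. objective N n Q r \<tau> i j x = 0)
    \<and> solution_set N n Q r \<tau>
        = nash_equilibria {1..N} (\<lambda>i. simplex_t (n i)) (reg_utility_t N n Q r \<tau>)"
proof -
  interpret regularized_game N n Q r \<tau>
    by unfold_locales (rule assms)
  let ?C = "constraint_set N n \<tau>" and ?K = "SIGMA i:{1..N}. {1..n i}"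
  obtain x0 where x0: "x0 \<in> profiles" "logit_equilibrium x0"
    using logit_equilibrium_exists by blast
  have "0 \<le> utility_range N n Q r"
    using utility_diff_le_range[of 1 N "lift N n x0" n "lift N n x0" Q r]
      lift_in_joint_simplex[OF x0(1)] \<open>N \<ge> 1\<close> by simp
  note bounds = temperature_bounds[OF \<open>\<tau> > 0\<close> this assms(4)]
  let ?l = "\<lambda>(i, j). objective N n Q r \<tau> i j"
  have zero_iff: "(\<forall>k\<in>?K. ?l k x = 0) \<longleftrightarrow> logit_equilibrium x" if "x \<in> ?C" for x
    using objectives_zero_iff_logit[of _ x] constraint_set_interior[OF that]
    unfolding logit_equilibrium_def by auto
  have equilibria: "{x \<in> ?C. logit_equilibrium x} = {x \<in> profiles. logit_equilibrium x}"
    using constraint_set_subset_profiles logit_equilibrium_in_constraint_set[OF _ _ bounds] by blast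
  then have x0C: "x0 \<in> ?C" using x0 by blast
  have nonneg: "0 \<le> ?l k x" for k x by (cases k) (simp add: objective_def)
  have zero_x0: "?l k x0 = 0" if "k \<in> ?K" for k
    using zero_iff[OF x0C] x0(2) that by blast
  have minimal_iff: "(\<forall>y\<in>?C. ?l k x \<le> ?l k y) \<longleftrightarrow> ?l k x = 0" if "k \<in> ?K" for k x
    using nonneg[of k] zero_x0[OF that] x0C by (metis antisym)
  have zeros: "solution_set N n Q r \<tau> = {x \<in> ?C. \<forall>k\<in>?K. ?l k x = 0}"
    unfolding solution_set_def simultaneous_minimizers_def
    by (intro Collect_cong conj_cong ball_cong refl minimal_iff)
  also have "\<dots> = {x \<in> profiles. logit_equilibrium x}"
    using zero_iff equilibria by blast
  finally have "solution_set N n Q r \<tau> = {x \<in> profiles. logit_equilibrium x}" .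
  moreover have "\<forall>i\<in>{1..N}. \<forall>j\<in>{1..n i}. objective N n Q r \<tau> i j x = 0"
    if "x \<in> solution_set N n Q r \<tau>" for x
    using that unfolding zeros by fastforce
  ultimately show ?thesis
    unfolding nash_equilibria_eq_logit_equilibria using x0 by auto
qed

end
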